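(* Let $\{U_k^{(n)}\}_{-1\le k\le K+1}$, $\{P_k^{(n)}\}_{-1\le k\le K+1}$ $(n=0,1,\ldots)$ be a solution of the scheme (S) given in the context. Then $$\delta_n^{+}J_{\rm d}(\boldsymbol U^{(n)}) = -\gamma\left|\delta_n^{+}U_0^{(n)}\right|^2-\gamma\left|\delta_n^{+}U_K^{(n)}\right|^2-\sum_{k=0}^{K-1}\left|\delta_k^{+}P_k^{(n)}\right|^2\Delta x\le 0\qquad (n=0,1,\ldots).$$
   Context: Let $L>0$, $\gamma>0$, $K$ a natural number, $\Delta x:=L/K$, and let $\Delta t>0$ be a time mesh size. $F:\mathbb R\to\mathbb R$ is a continuously differentiable potential, bounded from below. Difference operators: $\delta_k^+f_k=\frac{f_{k+1}-f_k}{\Delta x}$, $\delta_k^-f_k=\frac{f_k-f_{k-1}}{\Delta x}$, $\delta_k^{\langle1\rangle}f_k=\frac{f_{k+1}-f_{k-1}}{2\Delta x}$, $\delta_k^{\langle2\rangle}f_k=\frac{f_{k+1}-2f_k+f_{k-1}}{(\Delta x)^2}$, and $\delta_n^+f^{(n)}=\frac{f^{(n+1)}-f^{(n)}}{\Delta t}$. Difference quotient: $\frac{dF}{d(\xi,\eta)}:=\frac{F(\xi)-F(\eta)}{\xi-\eta}$ if $\xi\ne\eta$, and $:=F'(\eta)$ if $\xi=\eta$. Discrete energy, for $\boldsymbol U=\{U_k\}_{k=-1}^{K+1}\in\mathbb R^{K+3}$: with $G^{\pm}_{{\rm d},k}(\boldsymbol U):=\frac{\gamma}{2}(\delta_k^{\pm}U_k)^2+F(U_k)$,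 $k=0,\ldots,K$, $$J_{\rm d}(\boldsymbol U):=\frac12\Big\{\sum_{k=0}^{K-1}G^+_{{\rm d},k}(\boldsymbol U)\Delta x+\sum_{k=1}^{K}G^-_{{\rm d},k}(\boldsymbol U)\Delta x\Big\}.$$ Scheme (S): for all $n=0,1,\ldots$, (1) $\frac{U_k^{(n+1)}-U_k^{(n)}}{\Delta t}=\delta_k^{\langle2\rangle}P_k^{(n)}$ for $k=0,\ldots,K$; (2) $P_k^{(n)}=-\gamma\,\delta_k^{\langle2\rangle}\Big(\frac{U_k^{(n+1)}+U_k^{(n)}}{2}\Big)+\frac{dF}{d(U_k^{(n+1)},U_k^{(n)})}$ for $k=0,\ldots,K$; (3) $\frac{U_0^{(n+1)}-U_0^{(n)}}{\Delta t}=\delta_k^{\langle1\rangle}\Big(\frac{U_k^{(n+1)}+U_k^{(n)}}{2}\Big)\Big|_{k=0}$; (4) $\frac{U_K^{(n+1)}-U_K^{(n)}}{\Delta t}=-\delta_k^{\langle1\rangle}\Big(\frac{U_k^{(n+1)}+U_k^{(n)}}{2}\Big)\Big|_{k=K}$; (5) $\delta_k^{\langle1\rangle}P_k^{(n)}=0$ for $k=0,K$. The values at $k=-1$ and $k=K+1$ are artificial (ghost) quantities. $\boldsymbol U^{(n)}$ denotes $\{U_k^{(n)}\}_{k=-1}^{K+1}$. *)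

theory Defs
  imports "HOL-Analysis.Analysis"
begin

(* A grid vector indexed by -1, ..., K+1 is a function of type int => real. Its values at
   other indices are arbitrary: nothing below reads them for k in {0..K}. *)

definition fdiff :: "real \<Rightarrow> (int \<Rightarrow> real) \<Rightarrow> int \<Rightarrow> real" where
  "fdiff dx f k = (f (k + 1) - f k) / dx"

definition bdiff :: "real \<Rightarrow> (int \<Rightarrow> real) \<Rightarrow> int \<Rightarrow> real" where
  "bdiff dx f k = (f k - f (k - 1)) / dx"

definition cdiff1 :: "real \<Rightarrow> (int \<Rightarrow> real) \<Rightarrow> int \<Rightarrow> real" where
  "cdiff1 dx f k = (f (k + 1) - f (k - 1)) / (2 * dx)"

definition cdiff2 :: "real \<Rightarrow> (int \<Rightarrow> real) \<Rightarrow> int \<Rightarrow> real" where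
  "cdiff2 dx f k = (f (k + 1) - 2 * f k + f (k - 1)) / dx\<^sup>2"

definition tdiff :: "real \<Rightarrow> (nat \<Rightarrow> real) \<Rightarrow> nat \<Rightarrow> real" where
  "tdiff dt f n = (f (n + 1) - f n) / dt"

definition diff_quot :: "(real \<Rightarrow> real) \<Rightarrow> real \<Rightarrow> real \<Rightarrow> real" where
  "diff_quot F \<xi> \<eta> = (if \<xi> \<noteq> \<eta> then (F \<xi> - F \<eta>) / (\<xi> - \<eta>) else deriv F \<eta>)"

definition G_plus :: "real \<Rightarrow> real \<Rightarrow> (real \<Rightarrow> real) \<Rightarrow> (int \<Rightarrow> real) \<Rightarrow> int \<Rightarrow> real" where
  "G_plus \<gamma> dx F U k = \<gamma> / 2 * (fdiff dx U k)\<^sup>2 + F (U k)"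

definition G_minus :: "real \<Rightarrow> real \<Rightarrow> (real \<Rightarrow> real) \<Rightarrow> (int \<Rightarrow> real) \<Rightarrow> int \<Rightarrow> real" where
  "G_minus \<gamma> dx F U k = \<gamma> / 2 * (bdiff dx U k)\<^sup>2 + F (U k)"

definition J_d :: "real \<Rightarrow> real \<Rightarrow> nat \<Rightarrow> (real \<Rightarrow> real) \<Rightarrow> (int \<Rightarrow> real) \<Rightarrow> real" where
  "J_d \<gamma> dx K F U =
     1 / 2 * ((\<Sum>k = 0..int K - 1. G_plus \<gamma> dx F U k * dx)
            + (\<Sum>k = 1..int K. G_minus \<gamma> dx F U k * dx))"

(* U n k and P n k stand for the values at time step n and grid point k. *)

definition scheme_solution ::
  "real \<Rightarrow> real \<Rightarrow> real \<Rightarrow> nat \<Rightarrow> (real \<Rightarrow> real)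
    \<Rightarrow> (nat \<Rightarrow> int \<Rightarrow> real) \<Rightarrow> (nat \<Rightarrow> int \<Rightarrow> real) \<Rightarrow> bool" where
  "scheme_solution \<gamma> dx dt K F U P \<longleftrightarrow>
    (\<forall>n.
      (\<forall>k\<in>{0..int K}. (U (n + 1) k - U n k) / dt = cdiff2 dx (P n) k) \<and>
      (\<forall>k\<in>{0..int K}. P n k =
         - \<gamma> * cdiff2 dx (\<lambda>j. (U (n + 1) j + U n j) / 2) k
         + diff_quot F (U (n + 1) k) (U n k)) \<and>
      (U (n + 1) 0 - U n 0) / dt
         = cdiff1 dx (\<lambda>j. (U (n + 1) j + U n j) / 2) 0 \<and>
      (U (n + 1) (int K) - U n (int K)) / dt
         = - cdiff1 dx (\<lambda>j. (U (n + 1) j + U n j) / 2) (int K) \<and>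
      cdiff1 dx (P n) 0 = 0 \<and>
      cdiff1 dx (P n) (int K) = 0)"

end

(* Every sum over the grid is read as a trapezoidal rule, for which summation by parts leaves only
   the boundary terms f * cdiff1 g. In the energy increment it is applied once to the pair
   (time difference of U, time average of U), where the dynamic boundary conditions turn the
   boundary terms into squares, and once to the pair (P, P), where they vanish by the Neumann
   condition on P. *)

theory Submission
  imports Defs
begin

text \<open>The rule is summed cell by cell, not with half weights at the two end nodes, so that
  passing from \<open>K\<close> to \<open>Suc K\<close> adds a single summand.\<close>

definition trap :: "real \<Rightarrow> nat \<Rightarrow> (int \<Rightarrow> real) \<Rightarrow> real" where
  "trap dx K h = (\<Sum>k = 0..int K - 1. (h k + h (k + 1)) / 2 * dx)"

lemma trap_cong:
  assumes "\<And>k. k \<in> {0..int K} \<Longrightarrow> g k = h k"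
  shows "trap dx K g = trap dx K h"
  unfolding trap_def using assms by (intro sum.cong) auto

lemma trap_add: "trap dx K (\<lambda>k. g k + h k) = trap dx K g + trap dx K h"
  unfolding trap_def sum.distrib [symmetric]
  by (intro sum.cong) (auto simp: field_simps)

lemma trap_cmult: "trap dx K (\<lambda>k. c * h k) = c * trap dx K h"
  unfolding trap_def sum_distrib_left
  by (intro sum.cong) (auto simp: field_simps)

lemma sum_int_Suc:
  fixes h :: "int \<Rightarrow> 'a::comm_monoid_add"
  shows "(\<Sum>k = 0..int (Suc K) - 1. h k) = h (int K) + (\<Sum>k = 0..int K - 1. h k)"
proof -
  have "{0..int (Suc K) - 1} = insert (int K) {0..int K - 1}"
    by auto
  then show ?thesis
    by simp
qed

text \<open>On one cell the identity is plain algebra. Summing over cells telescopes the products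
  \<open>f * cdiff1 g\<close> at interior nodes, so only those at the two ends remain.\<close>

lemma trap_by_parts:
  assumes "dx \<noteq> 0"
  shows "trap dx K (\<lambda>k. f k * cdiff2 dx g k) =
    f (int K) * cdiff1 dx g (int K) - f 0 * cdiff1 dx g 0
    - (\<Sum>k = 0..int K - 1. fdiff dx f k * fdiff dx g k * dx)"
proof (induction K)
  case 0
  show ?case
    by (simp add: trap_def)
next
  case (Suc K)
  have "(f (int K) * cdiff2 dx g (int K) + f (int K + 1) * cdiff2 dx g (int K + 1)) / 2 * dx =
      f (int K + 1) * cdiff1 dx g (int K + 1) - f (int K) * cdiff1 dx g (int K)
      - fdiff dx f (int K) * fdiff dx g (int K) * dx"
    using assms unfolding cdiff2_def cdiff1_def fdiff_def
    by (simp add: field_simps power2_eq_square)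
  moreover have eq: "int (Suc K) = int K + 1"
    by simp
  ultimately show ?case
    using Suc.IH unfolding trap_def sum_int_Suc unfolding eq by linarith
qed

text \<open>A backward difference at \<open>k + 1\<close> is the forward difference at
  \<open>k\<close>. After this shift the two gradient sums coincide, while the two potential sums
  run over left and right cell endpoints and average to \<open>trap\<close>.\<close>

lemma J_d_eq:
  "J_d \<gamma> dx K F U =
    \<gamma> / 2 * (\<Sum>k = 0..int K - 1. (fdiff dx U k)\<^sup>2 * dx) + trap dx K (\<lambda>k. F (U k))"
proof -
  have "(\<Sum>k = 1..int K. G_minus \<gamma> dx F U k * dx) =
      (\<Sum>k = 0..int K - 1. G_minus \<gamma> dx F U (k + 1) * dx)"
    by (rule sum.reindex_bij_witness [of _ "\<lambda>k. k + 1" "\<lambda>k. k - 1"]) auto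
  then show ?thesis
    unfolding J_d_def trap_def sum_distrib_left sum.distrib [symmetric]
    by (simp add: sum_distrib_left sum.distrib [symmetric] G_plus_def G_minus_def fdiff_def
        bdiff_def algebra_simps add_divide_distrib)
qed

text \<open>A discrete chain rule: it expresses the increment of the potential exactly, with no
  remainder. At equal arguments both sides vanish.\<close>

lemma diff_quot_mult: "diff_quot F \<xi> \<eta> * (\<xi> - \<eta>) = F \<xi> - F \<eta>"
  by (simp add: diff_quot_def)

text \<open>Holds for arbitrary grid vectors; the scheme enters only in the theorem.\<close>

lemma J_d_increment:
  fixes U V :: "int \<Rightarrow> real"
  assumes "dt \<noteq> 0"
  defines "D \<equiv> \<lambda>k. (V k - U k) / dt" and "M \<equiv> \<lambda>k. (V k + U k) / 2"
  shows "(J_d \<gamma> dx K F V - J_d \<gamma> dx K F U) / dt =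
    \<gamma> * (\<Sum>k = 0..int K - 1. fdiff dx D k * fdiff dx M k * dx)
    + trap dx K (\<lambda>k. D k * diff_quot F (V k) (U k))"
proof -
  have grad: "(\<Sum>k = 0..int K - 1. (fdiff dx V k)\<^sup>2 * dx) =
      (\<Sum>k = 0..int K - 1. (fdiff dx U k)\<^sup>2 * dx)
      + 2 * dt * (\<Sum>k = 0..int K - 1. fdiff dx D k * fdiff dx M k * dx)"
  proof -
    \<comment> \<open>Difference of two squares: the difference of the gradients is
      \<open>dt * fdiff dx D k\<close>, their sum is \<open>2 * fdiff dx M k\<close>.\<close>
    have "(fdiff dx V k)\<^sup>2 * dx =
        (fdiff dx U k)\<^sup>2 * dx + 2 * dt * (fdiff dx D k * fdiff dx M k * dx)" for k
    proof -
      have "fdiff dx D k = (fdiff dx V k - fdiff dx U k) / dt"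
        and "fdiff dx M k = (fdiff dx V k + fdiff dx U k) / 2"
        by (simp_all add: fdiff_def D_def M_def diff_divide_distrib add_divide_distrib mult.commute)
      then show ?thesis
        using assms(1) by (simp only:) (simp add: field_simps power2_eq_square)
    qed
    then show ?thesis
      by (simp add: sum.distrib sum_distrib_left)
  qed
  have "F (V k) = F (U k) + dt * (D k * diff_quot F (V k) (U k))" for k
    using diff_quot_mult [of F "V k" "U k"] assms(1) by (simp add: D_def mult.commute)
  then have "trap dx K (\<lambda>k. F (V k)) =
      trap dx K (\<lambda>k. F (U k) + dt * (D k * diff_quot F (V k) (U k)))"
    by (intro trap_cong)
  then have pot: "trap dx K (\<lambda>k. F (V k)) =
      trap dx K (\<lambda>k. F (U k)) + dt * trap dx K (\<lambda>k. D k * diff_quot F (V k) (U k))"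
    by (simp only: trap_add trap_cmult)
  show ?thesis
    using assms(1) unfolding J_d_eq grad pot by (simp add: field_simps)
qed

theorem theorem2p1:
  fixes L \<gamma> dx dt :: real and K :: nat and F :: "real \<Rightarrow> real"
    and U P :: "nat \<Rightarrow> int \<Rightarrow> real"
  assumes "L > 0" and "\<gamma> > 0" and "K \<ge> 1" and "dx = L / real K" and "dt > 0"
    and "F C1_differentiable_on UNIV" and "bdd_below (range F)"
    and "scheme_solution \<gamma> dx dt K F U P"
  shows "\<forall>n.
    tdiff dt (\<lambda>m. J_d \<gamma> dx K F (U m)) n =
      - \<gamma> * \<bar>tdiff dt (\<lambda>m. U m 0) n\<bar>\<^sup>2
      - \<gamma> * \<bar>tdiff dt (\<lambda>m. U m (int K)) n\<bar>\<^sup>2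
      - (\<Sum>k = 0..int K - 1. \<bar>fdiff dx (P n) k\<bar>\<^sup>2 * dx) \<and>
    - \<gamma> * \<bar>tdiff dt (\<lambda>m. U m 0) n\<bar>\<^sup>2
      - \<gamma> * \<bar>tdiff dt (\<lambda>m. U m (int K)) n\<bar>\<^sup>2
      - (\<Sum>k = 0..int K - 1. \<bar>fdiff dx (P n) k\<bar>\<^sup>2 * dx) \<le> 0"
proof
  fix n
  have dx: "dx > 0"
    using assms by simp
  define D where "D = (\<lambda>k. (U (n + 1) k - U n k) / dt)"
  define M where "M = (\<lambda>k. (U (n + 1) k + U n k) / 2)"
  define q where "q = (\<lambda>k. diff_quot F (U (n + 1) k) (U n k))"
  have D: "D k = cdiff2 dx (P n) k" and P: "P n k = - \<gamma> * cdiff2 dx M k + q k"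
    if "k \<in> {0..int K}" for k
    using assms(8) that unfolding scheme_solution_def D_def M_def q_def by blast+
  \<comment> \<open>Both conditions say that \<open>D\<close> is minus the outward normal difference
    of \<open>M\<close>, so both boundary terms become negative squares.\<close>
  have D0: "cdiff1 dx M 0 = D 0" and DK: "cdiff1 dx M (int K) = - D (int K)"
    and P0: "cdiff1 dx (P n) 0 = 0" and PK: "cdiff1 dx (P n) (int K) = 0"
    using assms(8) unfolding scheme_solution_def D_def M_def by (metis minus_minus)+
  \<comment> \<open>Here \<open>q\<close> is \<open>P n\<close> plus \<open>\<gamma>\<close> times
    \<open>cdiff2 dx M\<close>. The factor \<open>D\<close> becomes \<open>cdiff2 dx (P n)\<close>
    only next to \<open>P n\<close>, which gives the dissipation; next to \<open>cdiff2 dx M\<close>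
    it stays.\<close>
  have "trap dx K (\<lambda>k. D k * q k) = trap dx K (\<lambda>k. P n k * cdiff2 dx (P n) k
      + \<gamma> * (D k * cdiff2 dx M k))"
    by (intro trap_cong) (simp add: P D algebra_simps)
  also have "\<dots> = - (\<Sum>k = 0..int K - 1. (fdiff dx (P n) k)\<^sup>2 * dx)
      + \<gamma> * (- (D (int K))\<^sup>2 - (D 0)\<^sup>2 - (\<Sum>k = 0..int K - 1. fdiff dx D k * fdiff dx M k * dx))"
    using dx by (simp add: trap_add trap_cmult trap_by_parts D0 DK P0 PK power2_eq_square)
  \<comment> \<open>The mixed sum of \<open>fdiff dx D k * fdiff dx M k\<close> cancels against the
    gradient part of the energy increment.\<close>
  finally have "tdiff dt (\<lambda>m. J_d \<gamma> dx K F (U m)) n =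
      - \<gamma> * (D 0)\<^sup>2 - \<gamma> * (D (int K))\<^sup>2 - (\<Sum>k = 0..int K - 1. (fdiff dx (P n) k)\<^sup>2 * dx)"
    using J_d_increment [of dt \<gamma> dx K F "U (n + 1)" "U n"] assms(5)
    unfolding tdiff_def D_def [symmetric] M_def [symmetric] q_def [symmetric]
    by (simp add: D_def M_def q_def algebra_simps)
  moreover have "0 \<le> (\<Sum>k = 0..int K - 1. (fdiff dx (P n) k)\<^sup>2 * dx)"
    using dx by (intro sum_nonneg) simp
  moreover have "0 \<le> \<gamma> * (D 0)\<^sup>2" "0 \<le> \<gamma> * (D (int K))\<^sup>2"
    using assms(2) by simp_all
  moreover have "tdiff dt (\<lambda>m. U m k) n = D k" for k
    by (simp add: tdiff_def D_def)
  ultimately show "tdiff dt (\<lambda>m. J_d \<gamma> dx K F (U m)) n =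
      - \<gamma> * \<bar>tdiff dt (\<lambda>m. U m 0) n\<bar>\<^sup>2
      - \<gamma> * \<bar>tdiff dt (\<lambda>m. U m (int K)) n\<bar>\<^sup>2
      - (\<Sum>k = 0..int K - 1. \<bar>fdiff dx (P n) k\<bar>\<^sup>2 * dx) \<and>
    - \<gamma> * \<bar>tdiff dt (\<lambda>m. U m 0) n\<bar>\<^sup>2
      - \<gamma> * \<bar>tdiff dt (\<lambda>m. U m (int K)) n\<bar>\<^sup>2
      - (\<Sum>k = 0..int K - 1. \<bar>fdiff dx (P n) k\<bar>\<^sup>2 * dx) \<le> 0"
    by simp
qed

end
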